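(* The uplink upper capacity bound $${\tt C}^{\mathrm{UL}}_{\mathrm{upper}}=\frac{T^{\mathrm{UL}}_{\mathrm{data}}}{T_{\mathrm{coher}}}\log_2\left(1+\frac{G^{\mathrm{UL}}}{1+\kappa_t^{\mathrm{UE}}G^{\mathrm{UL}}}\right),\quad G^{\mathrm{UL}}=\sum_{i=1}^N\frac{1}{\kappa_r^{\mathrm{BS}}}\left(1-\frac{\sigma_{\mathrm{BS}}^2}{p^{\mathrm{UE}}\kappa_r^{\mathrm{BS}}r_{ii}}e^{\frac{\sigma_{\mathrm{BS}}^2}{p^{\mathrm{UE}}\kappa_r^{\mathrm{BS}}r_{ii}}}E_1\!\left(\frac{\sigma_{\mathrm{BS}}^2}{p^{\mathrm{UE}}\kappa_r^{\mathrm{BS}}r_{ii}}\right)\right)$$ has the asymptotic properties $$\lim_{p^{\mathrm{UE}}\to\infty}{\tt C}^{\mathrm{UL}}_{\mathrm{upper}}=\frac{T^{\mathrm{UL}}_{\mathrm{data}}}{T_{\mathrm{coher}}}\log_2\left(1+\frac{N}{\kappa_r^{\mathrm{BS}}+\kappa_t^{\mathrm{UE}}N}\right),\qquad \lim_{N\to\infty}{\tt C}^{\mathrm{UL}}_{\mathrm{upper}}=\frac{T^{\mathrm{UL}}_{\mathrm{data}}}{T_{\mathrm{coher}}}\log_2\left(1+\frac{1}{\kappa_t^{\mathrm{UE}}}\right),$$ where $N$ is fixed in the first limit and all other parameters are fixed in the second.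
   Context: $N$ is the number of base station (BS) antennas, $r_{11},\dots,r_{NN}$ are the diagonal elements of the channel covariance matrix $\mathbf R\in\mathbb C^{N\times N}$ (positive semi-definite, depending on $N$), $p^{\mathrm{UE}}>0$ is the uplink transmit power, $\sigma_{\mathrm{BS}}^2>0$ the receiver noise variance at the BS, $\kappa_r^{\mathrm{BS}},\kappa_t^{\mathrm{UE}}>0$ the levels of hardware impairments of the BS receiver and the user transmitter, and $T^{\mathrm{UL}}_{\mathrm{data}}/T_{\mathrm{coher}}$ the fraction of channel uses for uplink data. $E_1(x)=\int_1^\infty\frac{e^{-tx}}{t}dt$. Standing assumptions on $\mathbf R$: $r_{ii}>0$ for all $i$; $\|\mathbf R\|_2=\mathcal O(1)$ as $N\to\infty$; $0<\liminf_N\frac1N\mathrm{tr}(\mathbf R)\le\limsup_N\frac1N\mathrm{tr}(\mathbf R)<\infty$. *)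

theory Defs
  imports
    "HOL-Analysis.Analysis"
    "HOL-Library.Landau_Symbols"
    "Jordan_Normal_Form.Schur_Decomposition"
begin

unbundle no vec_syntax and no inner_syntax

definition vec_norm2 :: "complex vec \<Rightarrow> real" where
  "vec_norm2 v = L2_set (\<lambda>i. cmod (v $ i)) {..<dim_vec v}"

definition spectral_norm :: "complex mat \<Rightarrow> real" where
  "spectral_norm A =
    (SUP v \<in> {v \<in> carrier_vec (dim_col A). vec_norm2 v \<le> 1}. vec_norm2 (A *\<^sub>v v))"

definition mat_trace :: "complex mat \<Rightarrow> complex" where
  "mat_trace A = sum_list (diag_mat A)"

text \<open>The scalar product below is \<open>v\<^sup>H A v\<close>, since \<open>u \<bullet>c v\<close> conjugates its second
  argument; it is real because \<open>A\<close> is Hermitian.\<close>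

definition pos_semidef :: "nat \<Rightarrow> complex mat \<Rightarrow> bool" where
  "pos_semidef n A \<longleftrightarrow> A \<in> carrier_mat n n \<and> mat_adjoint A = A \<and>
    (\<forall>v \<in> carrier_vec n. 0 \<le> Re ((A *\<^sub>v v) \<bullet>c v))"

definition E1 :: "real \<Rightarrow> real" where
  "E1 x = (LBINT t:{1..}. exp (- (t * x)) / t)"

text \<open>The arguments are the uplink power, the noise standard deviation (so that
  \<open>\<sigma>\<^sup>2\<close> is the noise variance), the impairment levels of the receiver and of the
  transmitter, and the channel covariance matrix. The number of antennas is the dimension of
  the matrix. The diagonal entries of a Hermitian matrix are real, so \<open>Re\<close> does not
  lose information.\<close>

definition G_UL :: "real \<Rightarrow> real \<Rightarrow> real \<Rightarrow> complex mat \<Rightarrow> real" where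
  "G_UL p \<sigma> \<kappa>r R =
    (\<Sum>i<dim_row R.
      let x = \<sigma>\<^sup>2 / (p * \<kappa>r * Re (R $$ (i, i)))
      in 1 / \<kappa>r * (1 - x * exp x * E1 x))"

definition C_UL_upper ::
  "real \<Rightarrow> real \<Rightarrow> real \<Rightarrow> real \<Rightarrow> real \<Rightarrow> real \<Rightarrow> complex mat \<Rightarrow> real" where
  "C_UL_upper T_data T_coher p \<sigma> \<kappa>r \<kappa>t R =
    T_data / T_coher * log 2 (1 + G_UL p \<sigma> \<kappa>r R / (1 + \<kappa>t * G_UL p \<sigma> \<kappa>r R))"

end

theory Submission
  imports Defs "HOL-Real_Asymp.Real_Asymp"
begin

text \<open>The function \<open>t \<mapsto> -exp (-t x) ln (1 + 1 / (t x))\<close> has a derivative dominating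
  the integrand of \<open>E1\<close>, so that \<open>0 \<le> x exp x E1 x \<le> x ln (1 + 1 / x)\<close>. The upper bound
  tends to \<open>0\<close> with \<open>x\<close>, hence every summand of \<open>G_UL\<close> tends to \<open>1 / \<kappa>r\<close> as the power
  grows. Since moreover \<open>ln (1 + y) \<le> y (y + 2) / (2 (y + 1))\<close>, each summand is at least
  \<open>1 / (2 \<kappa>r (x + 1))\<close>, which is at least a constant multiple of the diagonal entry because
  the diagonal entries are bounded by the spectral norm. So \<open>G_UL\<close> is at least a constant
  multiple of the trace, which grows linearly in the number of antennas.\<close>

section \<open>Bounds on the exponential integral\<close>

text \<open>The integrand is nonnegative; where the integral diverges, the Bochner integral is 0 by
  convention.\<close>

lemma E1_nonneg: "E1 x \<ge> 0"
  unfolding E1_def set_lebesgue_integral_def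
  by (intro integral_nonneg_AE AE_I2) (auto simp: indicator_def)

text \<open>Apply \<open>ln u \<le> u - 1\<close> at \<open>u = s / (s + 1)\<close>, the reciprocal
  of the argument of the logarithm.\<close>

lemma ln_one_plus_inverse_ge:
  fixes s :: real
  assumes "s > 0"
  shows "1 / (s + 1) \<le> ln (1 + 1 / s)"
proof -
  have "1 + 1 / s = (s + 1) / s" using assms by (simp add: field_simps)
  then have "ln (1 + 1 / s) = - ln (s / (s + 1))" using assms by (simp add: ln_div)
  moreover have "ln (s / (s + 1)) \<le> s / (s + 1) - 1"
    using assms by (intro ln_le_minus_one) auto
  moreover have "s / (s + 1) - 1 = - (1 / (s + 1))" using assms by (simp add: field_simps)
  ultimately show ?thesis by linarith
qed

lemma E1_le:
  assumes "x > 0"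
  shows "E1 x \<le> exp (- x) * ln (1 + 1 / x)"
proof -
  define F where "F = (\<lambda>t. - (exp (- (t * x)) * ln (1 + 1 / (t * x))))"
  \<comment> \<open>The derivative of \<open>F\<close>: the first summand comes from the exponential
    factor, the second from the logarithm.\<close>
  define f where "f = (\<lambda>t. exp (- (t * x)) * (x * ln (1 + 1 / (t * x)) + 1 / (t * (t * x + 1))))"
  have F_deriv: "(F has_real_derivative f t) (at t)" if "t \<ge> 1" for t
  proof -
    have pos: "t * x > 0" and "t > 0" using that assms by auto
    then have "1 + 1 / (t * x) > 0" "1 + t * x > 0" by (auto intro!: add_pos_pos)
    then show ?thesis unfolding F_def f_def
      using pos \<open>t > 0\<close> assms
      by (auto intro!: derivative_eq_intros)
        (simp add: divide_simps, simp add: algebra_simps)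
  qed
  have f_ge: "exp (- (t * x)) / t \<le> f t" if "t \<ge> 1" for t
  proof -
    have pos: "t * x > 0" and t: "t > 0" using that assms by auto
    \<comment> \<open>With this lower bound in place of the logarithm, the two summands in
      \<open>f\<close> add up to exactly \<open>1 / t\<close>.\<close>
    have "1 / (t * x + 1) \<le> ln (1 + 1 / (t * x))" by (rule ln_one_plus_inverse_ge [OF pos])
    then have "x * ln (1 + 1 / (t * x)) \<ge> x * (1 / (t * x + 1))"
      using assms by (intro mult_left_mono) auto
    moreover have "x * (1 / (t * x + 1)) + 1 / (t * (t * x + 1)) = 1 / t"
      using pos t by (simp add: divide_simps)
    ultimately have "1 / t \<le> x * ln (1 + 1 / (t * x)) + 1 / (t * (t * x + 1))" by linarith
    then show ?thesis unfolding f_def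
      using mult_left_mono[of "1 / t" _ "exp (- (t * x))"] by simp
  qed
  have F_lim: "(F \<longlongrightarrow> 0) at_top"
    unfolding F_def using assms by real_asymp
  have f_nonneg: "f t \<ge> 0" if "t \<ge> 1" for t
    using f_ge[OF that] that by (smt (verit) divide_nonneg_nonneg exp_ge_zero)
  \<comment> \<open>The nonnegative integral is monotone without any integrability condition; its
    finite bound then passes to the Bochner integral.\<close>
  have "(\<integral>\<^sup>+t. ennreal (indicator {1..} t *\<^sub>R (exp (- (t * x)) / t)) \<partial>lborel)
      \<le> (\<integral>\<^sup>+t. ennreal (f t) * indicator {1..} t \<partial>lborel)"
    using f_ge by (intro nn_integral_mono) (auto simp: indicator_def ennreal_leI)
  also have "\<dots> = ennreal (0 - F 1)"
  proof (rule nn_integral_FTC_atLeast)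
    show "f \<in> borel_measurable borel" unfolding f_def by measurable
  qed (use F_deriv f_nonneg F_lim in auto)
  finally have "E1 x \<le> 0 - F 1"
    unfolding E1_def set_lebesgue_integral_def
    using assms by (intro integral_real_bounded) (auto simp: F_def)
  then show ?thesis by (simp add: F_def)
qed

text \<open>The difference of the two sides vanishes at 0 and has a square as derivative, up to the
  factor 1/2. The cruder bound \<open>ln (1 + y) \<le> y\<close> would only show that the summands
  of \<open>G_UL\<close> are nonnegative.\<close>

lemma ln_one_plus_le:
  assumes "y \<ge> (0::real)"
  shows "ln (1 + y) \<le> y * (y + 2) / (2 * (y + 1))"
proof -
  define g where "g = (\<lambda>y::real. y * (y + 2) / (2 * (y + 1)) - ln (1 + y))"
  have "g 0 \<le> g y"
  proof (rule DERIV_nonneg_imp_nondecreasing [OF assms])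
    fix z :: real assume "0 \<le> z" "z \<le> y"
    then have "(g has_real_derivative (z / (1 + z))\<^sup>2 / 2) (at z)"
      unfolding g_def
      by (auto intro!: derivative_eq_intros)
        (simp add: divide_simps power2_eq_square, simp add: algebra_simps)
    then show "\<exists>d. (g has_real_derivative d) (at z) \<and> 0 \<le> d" by fastforce
  qed
  then show ?thesis by (simp add: g_def)
qed

lemma mult_exp_E1_nonneg: "x \<ge> 0 \<Longrightarrow> 0 \<le> x * exp x * E1 x"
  using E1_nonneg by simp

lemma mult_exp_E1_le:
  assumes "x > 0"
  shows "x * exp x * E1 x \<le> x * ln (1 + 1 / x)"
proof -
  have "x * exp x * E1 x \<le> x * exp x * (exp (- x) * ln (1 + 1 / x))"
    using E1_le[OF assms] assms by (intro mult_left_mono) auto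
  then show ?thesis by (simp add: exp_minus field_simps)
qed

text \<open>Squeezed between 0 and \<open>x * ln (1 + 1 / x)\<close>; the limit is one-sided because
  the upper bound holds for positive \<open>x\<close>.\<close>

lemma tendsto_mult_exp_E1: "((\<lambda>x. x * exp x * E1 x) \<longlongrightarrow> 0) (at_right 0)"
proof (rule tendsto_sandwich)
  show "\<forall>\<^sub>F x in at_right 0. 0 \<le> x * exp x * E1 x"
    by (rule eventually_at_rightI[of 0 1]) (use mult_exp_E1_nonneg in auto)
  show "\<forall>\<^sub>F x in at_right 0. x * exp x * E1 x \<le> x * ln (1 + 1 / x)"
    by (rule eventually_at_rightI[of 0 1]) (use mult_exp_E1_le in auto)
  show "((\<lambda>x::real. x * ln (1 + 1 / x)) \<longlongrightarrow> 0) (at_right 0)" by real_asymp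
qed simp

text \<open>Take \<open>y = 1 / x\<close> in \<open>ln_one_plus_le\<close>. The bound decays only
  like \<open>1 / x\<close>, and in \<open>G_UL\<close> the quantity \<open>1 / x\<close> is
  proportional to the diagonal entry.\<close>

lemma one_minus_mult_exp_E1_ge:
  assumes "x > 0"
  shows "1 / (2 * (x + 1)) \<le> 1 - x * exp x * E1 x"
proof -
  have "x * ln (1 + 1 / x) \<le> x * ((1 / x) * (1 / x + 2) / (2 * (1 / x + 1)))"
    using assms ln_one_plus_le[of "1 / x"] by (intro mult_left_mono) auto
  also have "\<dots> = 1 - 1 / (2 * (x + 1))"
    using assms by (simp add: divide_simps)
  finally show ?thesis using mult_exp_E1_le[OF assms] by linarith
qed

section \<open>Matrix entries and the spectral norm\<close>

text \<open>A crude bound, showing that the supremum in \<open>spectral_norm\<close> is over a set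
  bounded above. The Euclidean norm is at most the sum of the moduli, and the entries of
  \<open>v\<close> have modulus at most 1.\<close>

lemma vec_norm2_mult_le:
  assumes "v \<in> carrier_vec (dim_col A)" "vec_norm2 v \<le> 1"
  shows "vec_norm2 (A *\<^sub>v v) \<le> (\<Sum>i<dim_row A. \<Sum>j<dim_col A. cmod (A $$ (i, j)))"
proof -
  have entry: "cmod (v $ j) \<le> 1" if "j < dim_col A" for j
  proof -
    have "cmod (v $ j) \<le> vec_norm2 v"
      unfolding vec_norm2_def using that assms(1)
      by (intro member_le_L2_set) auto
    then show ?thesis using assms(2) by simp
  qed
  have "vec_norm2 (A *\<^sub>v v) \<le> (\<Sum>i<dim_row A. cmod ((A *\<^sub>v v) $ i))"
    using L2_set_le_sum[of "{..<dim_row A}" "\<lambda>i. cmod ((A *\<^sub>v v) $ i)"] by (simp add: vec_norm2_def)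
  also have "\<dots> \<le> (\<Sum>i<dim_row A. \<Sum>j<dim_col A. cmod (A $$ (i, j)))"
  proof (rule sum_mono)
    fix i assume "i \<in> {..<dim_row A}"
    then have "(A *\<^sub>v v) $ i = (\<Sum>j<dim_col A. A $$ (i, j) * v $ j)"
      using assms(1) by (auto simp: scalar_prod_def atLeast0LessThan)
    also have "cmod \<dots> \<le> (\<Sum>j<dim_col A. cmod (A $$ (i, j)))"
      using entry by (intro sum_norm_le) (auto simp: norm_mult intro: mult_left_le)
    finally show "cmod ((A *\<^sub>v v) $ i) \<le> (\<Sum>j<dim_col A. cmod (A $$ (i, j)))" .
  qed
  finally show ?thesis .
qed

text \<open>The entry is a coordinate of the image of a unit vector, which competes in the
  supremum.\<close>

lemma cmod_entry_le_spectral_norm: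
  assumes "i < dim_row A" "j < dim_col A"
  shows "cmod (A $$ (i, j)) \<le> spectral_norm A"
proof -
  let ?e = "unit_vec (dim_col A) j :: complex vec"
  have "vec_norm2 ?e = 1"
    using assms unfolding vec_norm2_def L2_set_def
    by (simp add: unit_vec_def if_distrib [of cmod] if_distrib [of "\<lambda>x. x\<^sup>2"] sum.delta cong: if_cong)
  have "A *\<^sub>v ?e = col A j" using assms by (intro eq_vecI) auto
  then have "cmod (A $$ (i, j)) = cmod ((A *\<^sub>v ?e) $ i)" using assms by simp
  also have "\<dots> \<le> vec_norm2 (A *\<^sub>v ?e)"
    unfolding vec_norm2_def using assms by (intro member_le_L2_set) auto
  also have "\<dots> \<le> spectral_norm A"
    unfolding spectral_norm_def
    using vec_norm2_mult_le[of _ A] \<open>vec_norm2 ?e = 1\<close>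
    by (intro cSUP_upper bdd_aboveI2[where M = "\<Sum>i<dim_row A. \<Sum>j<dim_col A. cmod (A $$ (i, j))"]) auto
  finally show ?thesis .
qed

lemma mat_trace_eq_sum: "mat_trace A = (\<Sum>i<dim_row A. A $$ (i, i))"
  by (simp add: mat_trace_def diag_mat_def interv_sum_list_conv_sum_set_nat atLeast0LessThan)

section \<open>Limit of \<open>G_UL\<close> in the power and its growth in the dimension\<close>

lemma G_UL_tendsto_power:
  assumes "\<sigma>\<^sup>2 > 0" "\<kappa>r > 0" "\<And>i. i < dim_row A \<Longrightarrow> Re (A $$ (i, i)) > 0"
  shows "((\<lambda>p. G_UL p \<sigma> \<kappa>r A) \<longlongrightarrow> real (dim_row A) / \<kappa>r) at_top"
proof -
  have "((\<lambda>p. G_UL p \<sigma> \<kappa>r A) \<longlongrightarrow> (\<Sum>i<dim_row A. 1 / \<kappa>r * (1 - 0))) at_top"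
    unfolding G_UL_def Let_def
  proof (intro tendsto_sum tendsto_mult tendsto_diff tendsto_const)
    fix i assume "i \<in> {..<dim_row A}"
    define r where "r = Re (A $$ (i, i))"
    define s where "s = \<sigma>\<^sup>2"
    have "r > 0" "s > 0" using assms \<open>i \<in> _\<close> by (auto simp: r_def s_def)
    \<comment> \<open>The argument approaches 0 through positive values, so the one-sided limit
      applies.\<close>
    then have "filterlim (\<lambda>p. s / (p * \<kappa>r * r)) (at_right 0) at_top"
      using \<open>\<kappa>r > 0\<close> by real_asymp
    from filterlim_compose [OF tendsto_mult_exp_E1 this]
    show "((\<lambda>p. \<sigma>\<^sup>2 / (p * \<kappa>r * Re (A $$ (i, i))) * exp (\<sigma>\<^sup>2 / (p * \<kappa>r * Re (A $$ (i, i))))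
        * E1 (\<sigma>\<^sup>2 / (p * \<kappa>r * Re (A $$ (i, i))))) \<longlongrightarrow> 0) at_top"
      by (simp add: r_def s_def)
  qed
  then show ?thesis by simp
qed

text \<open>For a diagonal entry \<open>r\<close>, the bound on its summand equals
  \<open>p * r / (2 * (\<sigma>\<^sup>2 + p * \<kappa>r * r))\<close>. Replacing \<open>r\<close> by
  \<open>B\<close> in the denominator alone makes it linear in \<open>r\<close>, so that it sums to
  the trace.\<close>

lemma G_UL_ge:
  assumes "\<sigma>\<^sup>2 > 0" "\<kappa>r > 0" "p > 0"
    and r: "\<And>i. i < dim_row A \<Longrightarrow> 0 < Re (A $$ (i, i)) \<and> Re (A $$ (i, i)) \<le> B"
  shows "p / (2 * (\<sigma>\<^sup>2 + p * \<kappa>r * B)) * Re (mat_trace A) \<le> G_UL p \<sigma> \<kappa>r A"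
proof -
  have "p / (2 * (\<sigma>\<^sup>2 + p * \<kappa>r * B)) * Re (A $$ (i, i)) \<le>
      (let x = \<sigma>\<^sup>2 / (p * \<kappa>r * Re (A $$ (i, i))) in 1 / \<kappa>r * (1 - x * exp x * E1 x))"
    if "i < dim_row A" for i
  proof -
    define r where "r = Re (A $$ (i, i))"
    define x where "x = \<sigma>\<^sup>2 / (p * \<kappa>r * r)"
    have rB: "0 < r" "r \<le> B" using assms(4) that by (auto simp: r_def)
    have "x > 0" using assms rB by (simp add: x_def)
    have "p / (2 * (\<sigma>\<^sup>2 + p * \<kappa>r * B)) * r \<le> p / (2 * (\<sigma>\<^sup>2 + p * \<kappa>r * r)) * r"
      using assms(1-3) rB
      by (intro mult_right_mono divide_left_mono mult_left_mono add_left_mono mult_pos_pos add_pos_pos) auto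
    also have "\<dots> = 1 / \<kappa>r * (1 / (2 * (x + 1)))"
      using assms(1-3) rB unfolding x_def
      by (simp add: field_simps add_pos_pos)
    also have "\<dots> \<le> 1 / \<kappa>r * (1 - x * exp x * E1 x)"
      using one_minus_mult_exp_E1_ge[OF \<open>x > 0\<close>] assms(2) by (intro mult_left_mono) auto
    finally show ?thesis by (simp add: x_def r_def Let_def)
  qed
  then show ?thesis
    unfolding G_UL_def mat_trace_eq_sum by (auto simp: sum_distrib_left intro!: sum_mono)
qed

lemma G_UL_at_top:
  fixes R :: "nat \<Rightarrow> complex mat"
  assumes dim: "\<And>N. N \<ge> 1 \<Longrightarrow> R N \<in> carrier_mat N N"
    and diag_pos: "\<And>N i. i < N \<Longrightarrow> Re (R N $$ (i, i)) > 0"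
    and bounded: "(\<lambda>N. spectral_norm (R N)) \<in> O(\<lambda>_. 1 :: real)"
    and liminf: "0 < liminf (\<lambda>N. ereal (1 / real N * Re (mat_trace (R N))))"
    and "\<sigma>\<^sup>2 > 0" "\<kappa>r > 0" "p > 0"
  shows "filterlim (\<lambda>N. G_UL p \<sigma> \<kappa>r (R N)) at_top sequentially"
proof -
  obtain B where "B > 0" and B: "\<forall>\<^sub>F N in sequentially. norm (spectral_norm (R N)) \<le> B"
    using bounded by (elim landau_o.bigE) auto
  \<comment> \<open>Any real \<open>d\<close> strictly between 0 and the limit inferior is
    eventually exceeded by the normalized trace.\<close>
  obtain d where "0 < ereal d" and "ereal d < liminf (\<lambda>N. ereal (1 / real N * Re (mat_trace (R N))))"
    using liminf ereal_dense2 by blast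
  then have "d > 0" and d: "\<forall>\<^sub>F N in sequentially. d < 1 / real N * Re (mat_trace (R N))"
    using less_LiminfD by fastforce+
  define c where "c = p / (2 * (\<sigma>\<^sup>2 + p * \<kappa>r * B))"
  have "c > 0" using assms(5-7) \<open>B > 0\<close> by (simp add: c_def add_pos_pos)
  have "filterlim (\<lambda>N. c * d * real N) at_top sequentially"
    using \<open>c > 0\<close> \<open>d > 0\<close> by real_asymp
  then show ?thesis
  proof (rule filterlim_at_top_mono)
    show "\<forall>\<^sub>F N in sequentially. c * d * real N \<le> G_UL p \<sigma> \<kappa>r (R N)"
      \<comment> \<open>\<open>N \<ge> 1\<close> gives access to the dimension hypothesis and allows
        multiplying the trace bound by \<open>N\<close>.\<close>
      using B d eventually_ge_at_top[of 1]
    proof eventually_elim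
      case (elim N)
      note carrier = carrier_matD[OF dim[OF elim(3)]]
      have diag: "0 < Re (R N $$ (i, i)) \<and> Re (R N $$ (i, i)) \<le> B" if "i < dim_row (R N)" for i
        using that carrier diag_pos[of i N] cmod_entry_le_spectral_norm[of i "R N" i]
          complex_Re_le_cmod[of "R N $$ (i, i)"] elim(1) by simp
      have "d * real N \<le> Re (mat_trace (R N))" using elim(2,3) by (simp add: field_simps)
      then have "c * d * real N \<le> c * Re (mat_trace (R N))" using \<open>c > 0\<close> by simp
      also have "\<dots> \<le> G_UL p \<sigma> \<kappa>r (R N)"
        unfolding c_def by (rule G_UL_ge) (use assms(5-7) diag in auto)
      finally show ?case .
    qed
  qed
qed

section \<open>Passage from \<open>G_UL\<close> to the capacity bound\<close>

theorem corollary3: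
  fixes R :: "nat \<Rightarrow> complex mat"
    and \<sigma> \<kappa>r \<kappa>t T_data T_coher :: real
  assumes R_psd: "\<And>N. N \<ge> 1 \<Longrightarrow> pos_semidef N (R N)"
    and R_diag_pos: "\<And>N i. i < N \<Longrightarrow> Re (R N $$ (i, i)) > 0"
    and R_norm_bounded: "(\<lambda>N. spectral_norm (R N)) \<in> O(\<lambda>_. 1 :: real)"
    and R_trace_liminf: "0 < liminf (\<lambda>N. ereal (1 / real N * Re (mat_trace (R N))))"
    and R_trace_limsup: "limsup (\<lambda>N. ereal (1 / real N * Re (mat_trace (R N)))) < \<infinity>"
    and noise_pos: "\<sigma>\<^sup>2 > 0"
    and kappa_r_pos: "\<kappa>r > 0"
    and kappa_t_pos: "\<kappa>t > 0"
    and fraction: "T_coher > 0" "0 \<le> T_data" "T_data \<le> T_coher"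
  shows "(\<forall>N\<ge>1. ((\<lambda>p. C_UL_upper T_data T_coher p \<sigma> \<kappa>r \<kappa>t (R N)) \<longlongrightarrow>
            T_data / T_coher * log 2 (1 + real N / (\<kappa>r + \<kappa>t * real N))) at_top) \<and>
         (\<forall>p>0. (\<lambda>N. C_UL_upper T_data T_coher p \<sigma> \<kappa>r \<kappa>t (R N)) \<longlonglongrightarrow>
            T_data / T_coher * log 2 (1 + 1 / \<kappa>t))"
proof (intro conjI allI impI)
  fix N :: nat assume "N \<ge> 1"
  have dim: "dim_row (R N) = N" using R_psd[OF \<open>N \<ge> 1\<close>] by (auto simp: pos_semidef_def)
  \<comment> \<open>The limit of \<open>G_UL\<close>; the capacity depends continuously on
    \<open>G_UL\<close> there, as the denominator and the argument of the logarithm are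
    positive.\<close>
  define g where "g = real N / \<kappa>r"
  have "g > 0" using \<open>N \<ge> 1\<close> kappa_r_pos by (simp add: g_def)
  have "1 + \<kappa>t * g > 0" "1 + g / (1 + \<kappa>t * g) > 0"
    using \<open>g > 0\<close> kappa_t_pos by (simp_all add: add_pos_pos)
  have "((\<lambda>p. G_UL p \<sigma> \<kappa>r (R N)) \<longlongrightarrow> g) at_top"
    using G_UL_tendsto_power[OF noise_pos kappa_r_pos, of "R N"] R_diag_pos by (simp add: dim g_def)
  then have "((\<lambda>p. C_UL_upper T_data T_coher p \<sigma> \<kappa>r \<kappa>t (R N)) \<longlongrightarrow>
      T_data / T_coher * log 2 (1 + g / (1 + \<kappa>t * g))) at_top"
    unfolding C_UL_upper_def using \<open>1 + \<kappa>t * g > 0\<close> \<open>1 + g / (1 + \<kappa>t * g) > 0\<close>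
    by (intro tendsto_intros) auto
  also have "g / (1 + \<kappa>t * g) = real N / (\<kappa>r + \<kappa>t * real N)"
    using kappa_r_pos by (simp add: g_def field_simps)
  finally show "((\<lambda>p. C_UL_upper T_data T_coher p \<sigma> \<kappa>r \<kappa>t (R N)) \<longlongrightarrow>
      T_data / T_coher * log 2 (1 + real N / (\<kappa>r + \<kappa>t * real N))) at_top" .
next
  fix p :: real assume "p > 0"
  have "filterlim (\<lambda>N. G_UL p \<sigma> \<kappa>r (R N)) at_top sequentially"
    using R_psd R_diag_pos R_norm_bounded R_trace_liminf noise_pos kappa_r_pos \<open>p > 0\<close>
    by (intro G_UL_at_top) (auto simp: pos_semidef_def)
  \<comment> \<open>Only the divergence of \<open>G_UL\<close> matters: the transmitter impairment
    makes the quotient saturate.\<close>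
  moreover have "((\<lambda>g. g / (1 + \<kappa>t * g)) \<longlongrightarrow> 1 / \<kappa>t) at_top"
    using kappa_t_pos by (real_asymp simp: field_simps)
  ultimately have "(\<lambda>N. G_UL p \<sigma> \<kappa>r (R N) / (1 + \<kappa>t * G_UL p \<sigma> \<kappa>r (R N))) \<longlonglongrightarrow> 1 / \<kappa>t"
    by (rule filterlim_compose[rotated])
  then show "(\<lambda>N. C_UL_upper T_data T_coher p \<sigma> \<kappa>r \<kappa>t (R N)) \<longlonglongrightarrow>
      T_data / T_coher * log 2 (1 + 1 / \<kappa>t)"
    unfolding C_UL_upper_def using kappa_t_pos
    by (intro tendsto_mult tendsto_log tendsto_add tendsto_const)
      (auto simp: add_pos_pos add_pos_pos [THEN less_imp_neq, symmetric])
qed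

end
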